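(* Let $\mathbf{x}^\ast$ be an optimal solution of the convex program and let $\boldsymbol{\lambda}^\ast\ge \mathbf{0}$ be a Lagrange multiplier vector attaining strong duality (both as described in the context). If $\alpha > \frac{\beta^2}{2}$ in the algorithm described in the context, then for all integers $t\ge 1$, \begin{align*} f(\overline{\mathbf{x}}(t)) &\le f(\mathbf{x}^\ast) + \frac{\alpha}{t}\Vert \mathbf{x}^\ast - \mathbf{x}(-1)\Vert^2,\\ g_k(\overline{\mathbf{x}}(t)) &\le \frac{1}{t}\Big(2\Vert \boldsymbol{\lambda}^\ast\Vert + \sqrt{2\alpha}\,\Vert \mathbf{x}^\ast - \mathbf{x}(-1)\Vert + \sqrt{\frac{\alpha}{\alpha-\frac12\beta^2}}\,\Vert \mathbf{g}(\mathbf{x}^\ast)\Vert\Big),\quad \forall k\in\{1,\ldots,m\}. \end{align*} In summary, the error decays like $O(1/t)$ and the algorithm provides an $\epsilon$-approximate solution with convergence time $O(1/\epsilon)$; that is, there is a constant $C$ (depending on the problem, $\alpha$ and $\mathbf{x}(-1)$, but not on $t$ or $\epsilon$) such that for every $\epsilon>0$ and every integer $t\ge \max\{1, C/\epsilon\}$ one has $f(\overline{\mathbf{x}}(t))\le f(\mathbf{x}^\ast)+\epsilon$ and $g_k(\overline{\mathbf{x}}(t))\le \epsilon$ for all $k\in\{1,\ldots,m\}$.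
   Context: $\Vert\cdot\Vert$ is the Euclidean norm. Fix positive integers $n,m$. Let $\mathcal{X}\subseteq\mathbb{R}^n$ be a closed convex set, $f:\mathcal{X}\to\mathbb{R}$ continuous and convex, and $g_1,\ldots,g_m:\mathcal{X}\to\mathbb{R}$ convex and Lipschitz continuous (no differentiability assumed). Write $\mathbf{g}(\mathbf{x})=[g_1(\mathbf{x}),\ldots,g_m(\mathbf{x})]^T$. The convex program is: minimize $f(\mathbf{x})$ subject to $g_k(\mathbf{x})\le 0$ for all $k\in\{1,\ldots,m\}$ and $\mathbf{x}\in\mathcal{X}$. Standing assumptions: (1) the convex program has a (possibly non-unique) optimal solution $\mathbf{x}^\ast\in\mathcal{X}$, and $\beta$ is a constant with $\Vert\mathbf{g}(\mathbf{x}_1)-\mathbf{g}(\mathbf{x}_2)\Vert\le\beta\Vert\mathbf{x}_1-\mathbf{x}_2\Vert$ for all $\mathbf{x}_1,\mathbf{x}_2\in\mathcal{X}$; (2) there is a Lagrange multiplier vector $\boldsymbol{\lambda}^\ast=[\lambda_1^\ast,\ldots,\lambda_m^\ast]^T\ge\mathbf{0}$ attaining strong duality, i.e. $q(\boldsymbol{\lambda}^\ast)=\min_{\mathbf{x}\in\mathcal{X}}\{f(\mathbf{x}): g_k(\mathbf{x})\le 0,\ \forall k\}$, where $q(\boldsymbol{\lambda})=\min_{\mathbf{x}\in\mathcal{X}}\{f(\mathbf{x})+\sum_{k=1}^m\lambda_k g_k(\mathbf{x})\}$. Algorithm: let $\alpha>0$ be a constant, choose any $\mathbf{x}(-1)\in\mathcal{X}$,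 and set $Q_k(0)=\max\{0,-g_k(\mathbf{x}(-1))\}$ for all $k$. With $\mathbf{Q}(t)=[Q_1(t),\ldots,Q_m(t)]^T$, at each iteration $t\in\{0,1,2,\ldots\}$ set $$\mathbf{x}(t)=\mathop{\mathrm{argmin}}_{\mathbf{x}\in\mathcal{X}}\Big\{f(\mathbf{x})+[\mathbf{Q}(t)+\mathbf{g}(\mathbf{x}(t-1))]^T\mathbf{g}(\mathbf{x})+\alpha\Vert\mathbf{x}-\mathbf{x}(t-1)\Vert^2\Big\},$$ $$Q_k(t+1)=\max\{-g_k(\mathbf{x}(t)),\,Q_k(t)+g_k(\mathbf{x}(t))\},\quad \forall k\in\{1,\ldots,m\}.$$ For $t\ge1$ define $\overline{\mathbf{x}}(t)=\frac1t\sum_{\tau=0}^{t-1}\mathbf{x}(\tau)$. *)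

theory Defs
  imports "HOL-Analysis.Analysis"
begin

definition feasible_set :: "(real^'n) set \<Rightarrow> (real^'n \<Rightarrow> real^'m) \<Rightarrow> (real^'n) set" where
  "feasible_set X g = {x \<in> X. \<forall>k. g x $ k \<le> 0}"

definition optimal_solution ::
    "(real^'n) set \<Rightarrow> (real^'n \<Rightarrow> real) \<Rightarrow> (real^'n \<Rightarrow> real^'m) \<Rightarrow> real^'n \<Rightarrow> bool" where
  "optimal_solution X f g x \<longleftrightarrow> is_arg_min f (\<lambda>y. y \<in> feasible_set X g) x"

(* The minima are taken as infima in the extended reals, since the Lagrangian need not be bounded
   below or attain its infimum for an arbitrary multiplier vector. At a multiplier attaining strong
   duality, an optimal solution attains both infima, so they are then genuine minima. *)
definition dual_function ::
    "(real^'n) set \<Rightarrow> (real^'n \<Rightarrow> real) \<Rightarrow> (real^'n \<Rightarrow> real^'m) \<Rightarrow> real^'m \<Rightarrow> ereal" where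
  "dual_function X f g lam = (INF x\<in>X. ereal (f x + (\<Sum>k\<in>UNIV. lam $ k * g x $ k)))"

definition optimal_value ::
    "(real^'n) set \<Rightarrow> (real^'n \<Rightarrow> real) \<Rightarrow> (real^'n \<Rightarrow> real^'m) \<Rightarrow> ereal" where
  "optimal_value X f g = (INF x\<in>feasible_set X g. ereal (f x))"

definition strong_duality_multiplier ::
    "(real^'n) set \<Rightarrow> (real^'n \<Rightarrow> real) \<Rightarrow> (real^'n \<Rightarrow> real^'m) \<Rightarrow> real^'m \<Rightarrow> bool" where
  "strong_duality_multiplier X f g lam \<longleftrightarrow>
     (\<forall>k. 0 \<le> lam $ k) \<and> dual_function X f g lam = optimal_value X f g"

(* The iterates x are indexed by int because they start at -1; values below -1 are irrelevant.
   The argmin is stated relationally: it is unique, because the weights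
   Q t + g (x (t - 1)) are nonnegative and the objective is therefore strongly convex. *)
definition algorithm_run ::
    "(real^'n) set \<Rightarrow> (real^'n \<Rightarrow> real) \<Rightarrow> (real^'n \<Rightarrow> real^'m) \<Rightarrow> real \<Rightarrow> real^'n \<Rightarrow>
     (int \<Rightarrow> real^'n) \<Rightarrow> (nat \<Rightarrow> real^'m) \<Rightarrow> bool" where
  "algorithm_run X f g \<alpha> x0 x Q \<longleftrightarrow>
     x (-1) = x0 \<and>
     (\<forall>k. Q 0 $ k = max 0 (- g (x (-1)) $ k)) \<and>
     (\<forall>t::nat.
        is_arg_min
          (\<lambda>y. f y + (Q t + g (x (int t - 1))) \<bullet> g y + \<alpha> * (norm (y - x (int t - 1)))\<^sup>2)
          (\<lambda>y. y \<in> X) (x (int t)) \<and>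
        (\<forall>k. Q (Suc t) $ k = max (- g (x (int t)) $ k) (Q t $ k + g (x (int t)) $ k)))"

definition running_average :: "(int \<Rightarrow> real^'n) \<Rightarrow> nat \<Rightarrow> real^'n" where
  "running_average x t = (1 / real t) *\<^sub>R (\<Sum>\<tau><t. x (int \<tau>))"

end

(*
  The weights Q t + g (x (t - 1)) are nonnegative, so each step minimises a strongly convex
  function, and comparing its value at the minimiser with the one at the optimal solution gives an
  inequality whose distance terms telescope. The cross term g (x (t - 1)) . g (x t) is expanded by
  polarisation; its square terms telescope together with the drift of |Q t|^2 / 2, and its
  remainder is absorbed by the proximal term because beta^2 / 2 < alpha. Since |Q t| dominates
  |g (x (t - 1))|, the objective bound follows. Strong duality bounds the accumulated objective from
  below by means of lam . Q t, which turns the same telescoped inequality into a bound on |Q t|,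
  and Q t dominates the accumulated constraint values.
*)
theory Submission
  imports Defs
begin

section \<open>Convexity, proximal minimisation and duality\<close>

lemma convex_on_inner_nonneg:
  fixes g :: "'a::real_vector \<Rightarrow> real^'m"
  assumes "convex X" "\<And>k. convex_on X (\<lambda>x. g x $ k)" "\<And>k. 0 \<le> w $ k"
  shows "convex_on X (\<lambda>x. w \<bullet> g x)"
  unfolding convex_on_def
proof (intro conjI ballI allI impI)
  fix x y and u v :: real
  assume "x \<in> X" "y \<in> X" "0 \<le> u" "0 \<le> v" "u + v = 1"
  then have "g (u *\<^sub>R x + v *\<^sub>R y) $ k \<le> u * g x $ k + v * g y $ k" for k
    using assms(2)[of k] unfolding convex_on_def by blast
  then have "(\<Sum>k\<in>UNIV. w $ k * g (u *\<^sub>R x + v *\<^sub>R y) $ k)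
      \<le> (\<Sum>k\<in>UNIV. w $ k * (u * g x $ k + v * g y $ k))"
    by (intro sum_mono mult_left_mono assms(3))
  also have "\<dots> = u * (\<Sum>k\<in>UNIV. w $ k * g x $ k) + v * (\<Sum>k\<in>UNIV. w $ k * g y $ k)"
    by (simp add: sum_distrib_left sum.distrib algebra_simps)
  finally show "w \<bullet> g (u *\<^sub>R x + v *\<^sub>R y) \<le> u * (w \<bullet> g x) + v * (w \<bullet> g y)"
    by (simp add: inner_vec_def)
qed (fact assms(1))

text \<open>The last term is the strong convexity of the squared norm, with equality; it is the
  source of the gain \<open>- \<alpha> * (norm (y - x))\<^sup>2\<close> in the proximal
  bound.\<close>

lemma norm_convex_combination_power2:
  fixes a b :: "'a::real_inner"
  shows "(norm ((1 - s) *\<^sub>R a + s *\<^sub>R b))\<^sup>2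
    = (1 - s) * (norm a)\<^sup>2 + s * (norm b)\<^sup>2 - s * (1 - s) * (norm (b - a))\<^sup>2"
  unfolding power2_norm_eq_inner
  by (simp add: inner_add_left inner_add_right inner_diff_left inner_diff_right inner_commute)
    (simp add: algebra_simps power2_eq_square)

text \<open>Without derivatives of \<open>h\<close>, the minimiser is compared with the points of
  the segment from \<open>x\<close> to \<open>y\<close>; the first-order information comes from
  letting the step \<open>s\<close> along it tend to 0.\<close>

lemma proximal_minimizer_bound:
  fixes h :: "'a::real_inner \<Rightarrow> real"
  assumes h: "convex_on X h"
    and min: "is_arg_min (\<lambda>y. h y + \<alpha> * (norm (y - z))\<^sup>2) (\<lambda>y. y \<in> X) x"
    and y: "y \<in> X"
  shows "h x + \<alpha> * (norm (x - z))\<^sup>2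
    \<le> h y + \<alpha> * (norm (y - z))\<^sup>2 - \<alpha> * (norm (y - x))\<^sup>2"
proof -
  let ?A = "h x + \<alpha> * (norm (x - z))\<^sup>2" and ?B = "h y + \<alpha> * (norm (y - z))\<^sup>2"
    and ?N = "\<alpha> * (norm (y - x))\<^sup>2"
  have x: "x \<in> X"
    and le: "\<And>p. p \<in> X \<Longrightarrow> ?A \<le> h p + \<alpha> * (norm (p - z))\<^sup>2"
    using min by (auto simp: is_arg_min_linorder)
  have "?A \<le> ?B - (1 - s) * ?N" if s: "0 < s" "s < 1" for s
  proof -
    let ?p = "(1 - s) *\<^sub>R x + s *\<^sub>R y"
    have hp: "h ?p \<le> (1 - s) * h x + s * h y"
      using h x y s unfolding convex_on_def by simp
    have "?p \<in> X"
      using h x y s unfolding convex_on_def convex_def by simp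
    have pz: "?p - z = (1 - s) *\<^sub>R (x - z) + s *\<^sub>R (y - z)"
      by (simp add: algebra_simps)
    have "?A \<le> h ?p + \<alpha> * (norm (?p - z))\<^sup>2"
      by (rule le) fact
    also have "(norm (?p - z))\<^sup>2 = (1 - s) * (norm (x - z))\<^sup>2 + s * (norm (y - z))\<^sup>2
        - s * (1 - s) * (norm (y - x))\<^sup>2"
      unfolding pz norm_convex_combination_power2 by simp
    \<comment> \<open>\<open>(1 - s) * ?A\<close> cancels, which leaves a common factor
      \<open>s > 0\<close> to divide by.\<close>
    finally have "s * ?A \<le> s * (?B - (1 - s) * ?N)"
      using hp by (simp add: algebra_simps)
    then show ?thesis
      using s by simp
  qed
  then have ev: "eventually (\<lambda>s. ?A \<le> ?B - (1 - s) * ?N) (at_right 0)"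
    by (auto simp: eventually_at_right_field intro!: exI[of _ 1])
  have "((\<lambda>s. ?B - (1 - s) * ?N) \<longlongrightarrow> ?B - (1 - 0) * ?N) (at_right 0)"
    by (intro tendsto_intros)
  then have "?A \<le> ?B - (1 - 0) * ?N"
    by (rule tendsto_lowerbound[OF _ ev]) simp
  then show ?thesis
    by simp
qed

lemma strong_duality_lower_bound:
  assumes opt: "optimal_solution X f g xstar"
    and dual: "strong_duality_multiplier X f g lam"
    and "x \<in> X"
  shows "f xstar \<le> f x + lam \<bullet> g x"
proof -
  have "ereal (f xstar) \<le> optimal_value X f g"
    using opt unfolding optimal_value_def optimal_solution_def is_arg_min_linorder
    by (auto intro!: INF_greatest)
  also have "\<dots> = dual_function X f g lam"
    using dual unfolding strong_duality_multiplier_def by simp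
  also have "\<dots> \<le> ereal (f x + (\<Sum>k\<in>UNIV. lam $ k * g x $ k))"
    unfolding dual_function_def by (rule INF_lower) fact
  finally show ?thesis
    by (simp add: inner_vec_def)
qed

lemma running_average_Jensen:
  assumes "convex_on X h" "\<And>\<tau>. x (int \<tau>) \<in> X" "t \<ge> 1"
  shows "h (running_average x t) \<le> (\<Sum>\<tau><t. h (x (int \<tau>))) / real t"
proof -
  have "h (\<Sum>\<tau><t. (1 / real t) *\<^sub>R x (int \<tau>)) \<le> (\<Sum>\<tau><t. (1 / real t) * h (x (int \<tau>)))"
    using assms by (intro convex_on_sum) (auto simp: lessThan_empty_iff)
  then show ?thesis
    by (simp add: running_average_def scaleR_sum_right sum_divide_distrib)
qed

section \<open>Scalar inequalities\<close>

text \<open>On the branch \<open>- a\<close> of the maximum the claim amounts to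
  \<open>0 \<le> (q + a)\<^sup>2 / 2\<close>, on the branch \<open>q + a\<close> to
  \<open>0 \<le> a\<^sup>2 / 2\<close>.\<close>

lemma virtual_queue_drift:
  fixes q a :: real
  shows "(max (- a) (q + a))\<^sup>2 / 2 - q\<^sup>2 / 2 \<le> q * a + a\<^sup>2"
proof -
  have "0 \<le> (q + a)\<^sup>2" "0 \<le> a\<^sup>2"
    by simp_all
  then show ?thesis
    by (auto simp: max_def power2_eq_square algebra_simps)
qed

text \<open>With \<open>c = \<alpha> - \<beta>\<^sup>2 / 2 > 0\<close> the left side is a concave
  quadratic in \<open>a\<close>; the right side is its maximum, attained at
  \<open>a = \<beta> * G / (2 * c)\<close>. This produces the fraction under the root in the
  constraint bound.\<close>

lemma completed_square_bound:
  fixes a G \<alpha> \<beta> :: real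
  assumes "\<beta>\<^sup>2 / 2 < \<alpha>"
  shows "(\<beta> * a + G)\<^sup>2 / 2 - \<alpha> * a\<^sup>2 \<le> (\<alpha> / (\<alpha> - 1 / 2 * \<beta>\<^sup>2)) * G\<^sup>2 / 2"
proof -
  define c where "c = \<alpha> - \<beta>\<^sup>2 / 2"
  have c: "c > 0" and \<alpha>: "\<alpha> = c + \<beta>\<^sup>2 / 2"
    using assms by (simp_all add: c_def)
  have "0 \<le> (2 * c * a - \<beta> * G)\<^sup>2 / (4 * c)"
    using c by simp
  also have "\<dots> = (\<alpha> / c) * G\<^sup>2 / 2 - ((\<beta> * a + G)\<^sup>2 / 2 - \<alpha> * a\<^sup>2)"
    using c unfolding \<alpha> by (simp add: field_simps power2_eq_square)
  finally show ?thesis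
    by (simp add: c_def)
qed

text \<open>Completing the square gives
  \<open>(q - l)\<^sup>2 \<le> l\<^sup>2 + a\<^sup>2 + b\<^sup>2\<close>, which is at most
  \<open>(l + a + b)\<^sup>2\<close>. Undoing the shift by \<open>l\<close> accounts for the factor
  2 in front of the multiplier norm.\<close>

lemma quadratic_root_bound:
  fixes q l a b :: real
  assumes "q\<^sup>2 / 2 - l * q \<le> a\<^sup>2 / 2 + b\<^sup>2 / 2" "0 \<le> l" "0 \<le> a" "0 \<le> b"
  shows "q \<le> 2 * l + a + b"
proof -
  have "0 \<le> l * a" "0 \<le> l * b" "0 \<le> a * b"
    using assms by simp_all
  then have "(q - l)\<^sup>2 \<le> (l + a + b)\<^sup>2"
    using assms(1) by (simp add: power2_eq_square algebra_simps)
  then have "q - l \<le> l + a + b"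
    by (rule power2_le_imp_le) (use assms in simp)
  then show ?thesis
    by simp
qed

section \<open>Invariants of the virtual queues\<close>

text \<open>A single run is fixed here; the quantifier over all runs in the theorem is recovered by
  interpretation.\<close>

locale primal_dual_run =
  fixes X :: "(real^'n) set"
    and f :: "real^'n \<Rightarrow> real"
    and g :: "real^'n \<Rightarrow> real^'m"
    and \<alpha> \<beta> :: real
    and x0 xstar :: "real^'n"
    and lam :: "real^'m"
    and x :: "int \<Rightarrow> real^'n"
    and Q :: "nat \<Rightarrow> real^'m"
  assumes convex_X: "convex X"
    and convex_f: "convex_on X f"
    and convex_g: "\<And>k. convex_on X (\<lambda>x. g x $ k)"
    and lipschitz_g: "\<And>x y. x \<in> X \<Longrightarrow> y \<in> X \<Longrightarrow> norm (g x - g y) \<le> \<beta> * norm (x - y)"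
    and optimal: "optimal_solution X f g xstar"
    and multiplier: "strong_duality_multiplier X f g lam"
    and x0_mem: "x0 \<in> X"
    and \<alpha>_gt: "\<alpha> > \<beta>\<^sup>2 / 2"
    and run: "algorithm_run X f g \<alpha> x0 x Q"
begin

lemma \<alpha>_pos: "0 < \<alpha>"
  using \<alpha>_gt zero_le_power2[of \<beta>] by linarith

lemma xstar_mem: "xstar \<in> X" and g_xstar: "g xstar $ k \<le> 0"
  using optimal by (auto simp: optimal_solution_def is_arg_min_def feasible_set_def)

lemma lam_nonneg: "0 \<le> lam $ k"
  using multiplier by (simp add: strong_duality_multiplier_def)

lemma x_start: "x (- 1) = x0"
  using run by (simp add: algorithm_run_def)

lemma Q_0: "Q 0 $ k = max 0 (- g x0 $ k)"
  using run by (simp add: algorithm_run_def)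

lemma Q_Suc: "Q (Suc t) $ k = max (- g (x (int t)) $ k) (Q t $ k + g (x (int t)) $ k)"
  using run by (simp add: algorithm_run_def)

lemma x_min:
  "is_arg_min (\<lambda>y. (f y + (Q t + g (x (int t - 1))) \<bullet> g y) + \<alpha> * (norm (y - x (int t - 1)))\<^sup>2)
     (\<lambda>y. y \<in> X) (x (int t))"
  using run by (simp add: algorithm_run_def)

lemma x_mem: "x (int t) \<in> X"
  using x_min[of t] by (simp add: is_arg_min_def)

lemma x_pred_mem: "x (int t - 1) \<in> X"
  by (cases t) (use x_mem x_start x0_mem in auto)

lemma Q_nonneg: "0 \<le> Q t $ k"
proof (induction t)
  case 0
  then show ?case by (simp add: Q_0)
next
  case (Suc t)
  then show ?case by (simp add: Q_Suc le_max_iff_disj) linarith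
qed

text \<open>The first argument of \<open>max\<close> makes \<open>Q t\<close> dominate
  \<open>- g (x (t - 1))\<close>; at \<open>t = 0\<close> the initialisation does. This keeps the
  weighted constraint term convex, and nonpositive at \<open>xstar\<close>.\<close>

lemma weight_nonneg: "0 \<le> (Q t + g (x (int t - 1))) $ k"
  by (cases t) (auto simp: Q_0 Q_Suc x_start)

text \<open>Negative components of \<open>g\<close> are covered by the first argument of
  \<open>max\<close>, the others by the second together with \<open>0 \<le> Q t\<close>.\<close>

lemma norm_g_le_norm_Q: "norm (g (x (int t))) \<le> norm (Q (Suc t))"
proof (rule norm_le_componentwise_cart)
  show "norm (g (x (int t)) $ k) \<le> norm (Q (Suc t) $ k)" for k
    using Q_nonneg[of t k] by (simp add: Q_Suc)
qed

lemma norm_Q_0_le: "norm (Q 0) \<le> norm (g x0)"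
  by (rule norm_le_componentwise_cart) (simp add: Q_0)

text \<open>The second argument of \<open>max\<close> makes each queue grow by at least the current
  constraint value, from a nonnegative start.\<close>

lemma sum_g_le_Q: "(\<Sum>\<tau><t. g (x (int \<tau>))) $ k \<le> Q t $ k"
proof (induction t)
  case 0
  then show ?case by (simp add: Q_0)
next
  case (Suc t)
  then show ?case by (simp add: Q_Suc)
qed

lemma drift:
  "(norm (Q (Suc t)))\<^sup>2 / 2 - (norm (Q t))\<^sup>2 / 2
    \<le> Q t \<bullet> g (x (int t)) + (norm (g (x (int t))))\<^sup>2"
proof -
  have "(\<Sum>k\<in>UNIV. (Q (Suc t) $ k)\<^sup>2 / 2 - (Q t $ k)\<^sup>2 / 2)
      \<le> (\<Sum>k\<in>UNIV. Q t $ k * g (x (int t)) $ k + (g (x (int t)) $ k)\<^sup>2)"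
    unfolding Q_Suc by (intro sum_mono virtual_queue_drift)
  then show ?thesis
    by (simp add: power2_norm_eq_inner inner_vec_def sum_subtractf sum.distrib
        flip: sum_divide_distrib power2_eq_square)
qed

section \<open>Telescoping, and bounds on the accumulated objective and on the queues\<close>

text \<open>The drift costs all of \<open>|g (x t)|^2\<close>; polarising the cross term returns
  half of it and half of \<open>|g (x (t - 1))|^2\<close>, so that a telescoping difference
  remains.\<close>

lemma step_bound:
  "f (x (int t)) + ((norm (Q (Suc t)))\<^sup>2 / 2 - (norm (Q t))\<^sup>2 / 2)
    \<le> f xstar
      + \<alpha> * ((norm (xstar - x (int t - 1)))\<^sup>2 - (norm (xstar - x (int t)))\<^sup>2)
      + ((norm (g (x (int t))))\<^sup>2 - (norm (g (x (int t - 1))))\<^sup>2) / 2"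
proof -
  let ?w = "Q t + g (x (int t - 1))"
  let ?d = "norm (x (int t) - x (int t - 1))"
  have "convex_on X (\<lambda>y. f y + ?w \<bullet> g y)"
    by (intro convex_on_add convex_f convex_on_inner_nonneg convex_X convex_g weight_nonneg)
  from proximal_minimizer_bound[OF this x_min xstar_mem]
  have prox: "f (x (int t)) + ?w \<bullet> g (x (int t)) + \<alpha> * ?d\<^sup>2
      \<le> f xstar + ?w \<bullet> g xstar + \<alpha> * (norm (xstar - x (int t - 1)))\<^sup>2
        - \<alpha> * (norm (xstar - x (int t)))\<^sup>2" .
  have feas: "?w \<bullet> g xstar \<le> 0"
    unfolding inner_vec_def
    using weight_nonneg g_xstar by (auto intro!: sum_nonpos simp: mult_nonneg_nonpos)
  have "(norm (g (x (int t)) - g (x (int t - 1))))\<^sup>2 \<le> (\<beta> * ?d)\<^sup>2"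
    by (intro power_mono lipschitz_g x_mem x_pred_mem norm_ge_zero)
  also have "\<dots> = \<beta>\<^sup>2 * ?d\<^sup>2"
    by (simp add: power_mult_distrib)
  \<comment> \<open>The lower bound on \<open>\<alpha>\<close> lets the proximal term absorb the
    polarisation remainder.\<close>
  also have "\<dots> \<le> (2 * \<alpha>) * ?d\<^sup>2"
    using \<alpha>_gt by (intro mult_right_mono) auto
  finally have "(norm (g (x (int t))))\<^sup>2 + (norm (g (x (int t - 1))))\<^sup>2
      - 2 * (g (x (int t - 1)) \<bullet> g (x (int t))) \<le> 2 * (\<alpha> * ?d\<^sup>2)"
    by (simp add: power2_norm_eq_inner inner_diff_left inner_diff_right inner_commute)
  then show ?thesis
    using prox feas drift[of t] unfolding inner_add_left right_diff_distrib diff_divide_distrib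
    by linarith
qed

lemma telescoped_bound:
  "(\<Sum>\<tau><t. f (x (int \<tau>))) + (norm (Q t))\<^sup>2 / 2
    \<le> real t * f xstar
      + \<alpha> * ((norm (xstar - x0))\<^sup>2 - (norm (xstar - x (int t - 1)))\<^sup>2)
      + (norm (g (x (int t - 1))))\<^sup>2 / 2"
proof (induction t)
  case 0
  \<comment> \<open>At \<open>t = 0\<close> the index \<open>int t - 1\<close> is -1, so the
    distances cancel and only \<open>Q 0\<close> and \<open>g x0\<close> are compared.\<close>
  have "(norm (Q 0))\<^sup>2 \<le> (norm (g x0))\<^sup>2"
    by (intro power_mono norm_Q_0_le norm_ge_zero)
  then show ?case by (simp add: x_start)
next
  case (Suc t)
  then show ?case
    using step_bound[of t] by (simp add: algebra_simps diff_divide_distrib)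
qed

text \<open>The leftover \<open>|g (x (t - 1))|^2 / 2\<close> is absorbed by
  \<open>|Q t|^2 / 2\<close>: for \<open>t \<ge> 1\<close> the queue \<open>Q t\<close> has just
  been updated with \<open>g (x (t - 1))\<close>.\<close>

lemma sum_f_le:
  assumes "t \<ge> 1"
  shows "(\<Sum>\<tau><t. f (x (int \<tau>))) \<le> real t * f xstar + \<alpha> * (norm (xstar - x0))\<^sup>2"
proof -
  have "norm (g (x (int t - 1))) \<le> norm (Q t)"
    using norm_g_le_norm_Q[of "t - 1"] assms by (simp add: of_nat_diff)
  then have "(norm (g (x (int t - 1))))\<^sup>2 \<le> (norm (Q t))\<^sup>2"
    by (intro power_mono norm_ge_zero)
  moreover have "0 \<le> \<alpha> * (norm (xstar - x (int t - 1)))\<^sup>2"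
    using \<alpha>_pos by simp
  ultimately show ?thesis
    using telescoped_bound[of t] unfolding right_diff_distrib by linarith
qed

text \<open>Strong duality bounds the Lagrangian from below at every iterate; since
  \<open>lam\<close> is nonnegative, \<open>Q t\<close> may replace the accumulated constraint
  values.\<close>

lemma sum_f_ge:
  "real t * f xstar - norm lam * norm (Q t) \<le> (\<Sum>\<tau><t. f (x (int \<tau>)))"
proof -
  have "(\<Sum>\<tau><t. f xstar) \<le> (\<Sum>\<tau><t. f (x (int \<tau>)) + lam \<bullet> g (x (int \<tau>)))"
    by (intro sum_mono strong_duality_lower_bound[OF optimal multiplier] x_mem)
  then have "real t * f xstar
      \<le> (\<Sum>\<tau><t. f (x (int \<tau>))) + lam \<bullet> (\<Sum>\<tau><t. g (x (int \<tau>)))"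
    by (simp add: sum.distrib inner_sum_right)
  also have "lam \<bullet> (\<Sum>\<tau><t. g (x (int \<tau>))) \<le> lam \<bullet> Q t"
    unfolding inner_vec_def
    using lam_nonneg sum_g_le_Q by (auto intro!: sum_mono mult_left_mono simp del: sum_component)
  also have "lam \<bullet> Q t \<le> norm lam * norm (Q t)"
    by (rule norm_cauchy_schwarz)
  finally show ?thesis
    by simp
qed

text \<open>Here the leftover \<open>g (x (t - 1))\<close> is compared with \<open>g xstar\<close>
  instead of \<open>Q t\<close>; the Lipschitz cost is paid by the negative distance term of the
  telescoped bound. A quadratic inequality in \<open>norm (Q t)\<close> remains.\<close>

lemma norm_Q_le:
  "norm (Q t) \<le> 2 * norm lam + sqrt (2 * \<alpha>) * norm (xstar - x0)
    + sqrt (\<alpha> / (\<alpha> - 1 / 2 * \<beta>\<^sup>2)) * norm (g xstar)"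
proof (rule quadratic_root_bound)
  let ?y = "x (int t - 1)" and ?r = "\<alpha> / (\<alpha> - 1 / 2 * \<beta>\<^sup>2)"
  have r: "0 \<le> ?r"
    using \<alpha>_pos \<alpha>_gt by simp
  have "norm (g ?y) \<le> norm (g ?y - g xstar) + norm (g xstar)"
    using norm_triangle_ineq[of "g ?y - g xstar" "g xstar"] by simp
  also have "norm (g ?y - g xstar) \<le> \<beta> * norm (xstar - ?y)"
    using lipschitz_g[OF x_pred_mem xstar_mem, of t] by (simp add: norm_minus_commute)
  finally have "(norm (g ?y))\<^sup>2 \<le> (\<beta> * norm (xstar - ?y) + norm (g xstar))\<^sup>2"
    by (intro power_mono) auto
  then have "(norm (g ?y))\<^sup>2 / 2 - \<alpha> * (norm (xstar - ?y))\<^sup>2 \<le> ?r * (norm (g xstar))\<^sup>2 / 2"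
    using completed_square_bound[OF \<alpha>_gt, of "norm (xstar - ?y)" "norm (g xstar)"] by linarith
  then have "(norm (Q t))\<^sup>2 / 2 - norm lam * norm (Q t)
      \<le> \<alpha> * (norm (xstar - x0))\<^sup>2 + ?r * (norm (g xstar))\<^sup>2 / 2"
    using telescoped_bound[of t] sum_f_ge[of t] unfolding right_diff_distrib by linarith
  \<comment> \<open>Both terms are written as halved squares to serve as \<open>a\<close> and
    \<open>b\<close> in \<open>quadratic_root_bound\<close>.\<close>
  also have "\<dots> = (sqrt (2 * \<alpha>) * norm (xstar - x0))\<^sup>2 / 2 + (sqrt ?r * norm (g xstar))\<^sup>2 / 2"
    using \<alpha>_pos r by (simp add: power_mult_distrib)
  finally show "(norm (Q t))\<^sup>2 / 2 - norm lam * norm (Q t)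
      \<le> (sqrt (2 * \<alpha>) * norm (xstar - x0))\<^sup>2 / 2 + (sqrt ?r * norm (g xstar))\<^sup>2 / 2" .
  show "0 \<le> sqrt ?r * norm (g xstar)"
    using r by (intro mult_nonneg_nonneg real_sqrt_ge_zero norm_ge_zero)
qed (use \<alpha>_pos in simp_all)

section \<open>Bounds at the running averages and the convergence rate\<close>

lemma objective_bound:
  assumes "t \<ge> 1"
  shows "f (running_average x t) \<le> f xstar + \<alpha> / real t * (norm (xstar - x0))\<^sup>2"
proof -
  have "f (running_average x t) \<le> (\<Sum>\<tau><t. f (x (int \<tau>))) / real t"
    by (rule running_average_Jensen[where x = x, OF convex_f x_mem assms])
  also have "\<dots> \<le> (real t * f xstar + \<alpha> * (norm (xstar - x0))\<^sup>2) / real t"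
    by (intro divide_right_mono sum_f_le assms) simp
  finally show ?thesis
    using assms by (simp add: field_simps)
qed

lemma constraint_bound:
  assumes "t \<ge> 1"
  shows "g (running_average x t) $ k \<le> 1 / real t * (2 * norm lam
    + sqrt (2 * \<alpha>) * norm (xstar - x0) + sqrt (\<alpha> / (\<alpha> - 1 / 2 * \<beta>\<^sup>2)) * norm (g xstar))"
proof -
  have "g (running_average x t) $ k \<le> (\<Sum>\<tau><t. g (x (int \<tau>)) $ k) / real t"
    by (rule running_average_Jensen[where x = x, OF convex_g x_mem assms])
  also have "\<dots> \<le> norm (Q t) / real t"
    using sum_g_le_Q[of t k] component_le_norm_cart[of "Q t" k]
    by (intro divide_right_mono) auto
  also have "\<dots> \<le> (2 * norm lam + sqrt (2 * \<alpha>) * norm (xstar - x0)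
      + sqrt (\<alpha> / (\<alpha> - 1 / 2 * \<beta>\<^sup>2)) * norm (g xstar)) / real t"
    by (intro divide_right_mono norm_Q_le) simp
  finally show ?thesis
    by simp
qed

end

theorem theorem3:
  fixes X :: "(real^'n) set"
    and f :: "real^'n \<Rightarrow> real"
    and g :: "real^'n \<Rightarrow> real^'m"
    and \<alpha> \<beta> :: real
    and x0 xstar :: "real^'n"
    and lam :: "real^'m"
  assumes "closed X" and "convex X"
    and "continuous_on X f" and "convex_on X f"
    and "\<And>k. convex_on X (\<lambda>x. g x $ k)"
    and "\<And>k. \<exists>L. L-lipschitz_on X (\<lambda>x. g x $ k)"
    and "\<And>x y. x \<in> X \<Longrightarrow> y \<in> X \<Longrightarrow> norm (g x - g y) \<le> \<beta> * norm (x - y)"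
    and "optimal_solution X f g xstar"
    and "strong_duality_multiplier X f g lam"
    and "x0 \<in> X"
    and "\<alpha> > 0" and "\<alpha> > \<beta>\<^sup>2 / 2"
  shows "(\<forall>x Q. algorithm_run X f g \<alpha> x0 x Q \<longrightarrow>
           (\<forall>t\<ge>1.
              f (running_average x t) \<le> f xstar + \<alpha> / real t * (norm (xstar - x0))\<^sup>2 \<and>
              (\<forall>k. g (running_average x t) $ k \<le>
                 1 / real t * (2 * norm lam + sqrt (2 * \<alpha>) * norm (xstar - x0)
                   + sqrt (\<alpha> / (\<alpha> - 1 / 2 * \<beta>\<^sup>2)) * norm (g xstar))))) \<and>
         (\<exists>C::real. \<forall>x Q. algorithm_run X f g \<alpha> x0 x Q \<longrightarrow>
           (\<forall>\<epsilon>>0. \<forall>t::nat. real t \<ge> max 1 (C / \<epsilon>) \<longrightarrow>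
              f (running_average x t) \<le> f xstar + \<epsilon> \<and>
              (\<forall>k. g (running_average x t) $ k \<le> \<epsilon>)))"
proof -
  let ?A = "\<alpha> * (norm (xstar - x0))\<^sup>2"
    and ?K = "2 * norm lam + sqrt (2 * \<alpha>) * norm (xstar - x0)
      + sqrt (\<alpha> / (\<alpha> - 1 / 2 * \<beta>\<^sup>2)) * norm (g xstar)"
  have bounds: "f (running_average x t) \<le> f xstar + \<alpha> / real t * (norm (xstar - x0))\<^sup>2
      \<and> (\<forall>k. g (running_average x t) $ k \<le> 1 / real t * ?K)"
    if "algorithm_run X f g \<alpha> x0 x Q" "t \<ge> 1" for x Q t
  proof -
    interpret primal_dual_run X f g \<alpha> \<beta> x0 xstar lam x Q
      using assms that by unfold_locales
    show ?thesis
      using objective_bound constraint_bound that by blast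
  qed
  \<comment> \<open>\<open>max ?A ?K\<close> is the witness for \<open>C\<close>: both error bounds
    are of the form \<open>c / real t\<close> with \<open>c\<close> at most this maximum, which does
    not depend on the run.\<close>
  have rate: "c / real t \<le> \<epsilon>"
    if "0 < \<epsilon>" "real t \<ge> max 1 (max ?A ?K / \<epsilon>)" "c \<le> max ?A ?K" for c \<epsilon> :: real and t
  proof -
    have "max ?A ?K / \<epsilon> \<le> real t" and "1 \<le> real t"
      using that(2) by (auto elim: max.boundedE)
    then have "max ?A ?K \<le> \<epsilon> * real t" and "0 < real t"
      using that(1) by (auto simp: pos_divide_le_eq mult.commute)
    then show ?thesis
      using that(3) by (simp add: pos_divide_le_eq del: max.bounded_iff)
  qed
  have "f (running_average x t) \<le> f xstar + \<epsilon> \<and> (\<forall>k. g (running_average x t) $ k \<le> \<epsilon>)"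
    if run: "algorithm_run X f g \<alpha> x0 x Q" and \<epsilon>: "0 < \<epsilon>"
      and t: "real t \<ge> max 1 (max ?A ?K / \<epsilon>)" for x Q \<epsilon> t
  proof -
    have "t \<ge> 1"
      using t by simp
    from bounds[OF run this] show ?thesis
      using rate[OF \<epsilon> t, of ?A] rate[OF \<epsilon> t, of ?K] by (auto intro: order_trans)
  qed
  with bounds show ?thesis
    by blast
qed

end
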